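(* Let $L_f>0$ and let $f\colon\mathcal H\to\mathbb R$ be Fréchet differentiable and $L_f$-smooth. Let $(C_i)_{i\in I}$ be a finite collection of nonempty compact convex subsets of $\mathcal H$ with diameters $\{R_i\}_{i\in I}\subset[0,+\infty[$ such that $\bigcap_{i\in I}C_i\neq\varnothing$. For every $\lambda\ge 0$, set $F_\lambda\colon\boldsymbol{\mathcal H}\to\left]-\infty,+\infty\right]\colon \boldsymbol x\mapsto f(A\boldsymbol x)+\frac{\lambda}{2}\operatorname{dist}_{\boldsymbol D}^2(\boldsymbol x)$. For every $t\ge 0$ set $\gamma_t=1/\sqrt{t+1}$, let $\lambda_0>0$, and for every $t\geq 1$ set $\lambda_t=\lambda_0\sum_{k=0}^{t-1}\frac{1}{k+1}$. Let $(\boldsymbol x_t)_{t\in\mathbb N}$ be the iterates of the split conditional gradient algorithm (described in the context) with these parameters. Then, for every $t\ge 1$, $$0\le\frac1t\sum_{k=0}^{t-1}\ \sup_{\boldsymbol v\in\prod_{i\in I}C_i}\langle \nabla F_{\lambda_k}(\boldsymbol x_k)\mid \boldsymbol x_k-\boldsymbol v\rangle_{\boldsymbol{\mathcal H}}\le \mathcal O\!\left(\frac{\ln t}{\sqrt t}+\frac{1}{\sqrt t}\right),$$ where the implied constant does not depend on $t$. In particular, there exists a subsequence $(t_k)_{k\in\mathbb N}$ such that $$\sup_{\boldsymbol v\in\prod_{i\in I}C_i}\langle\nabla F_{\lambda_{t_k}}(\boldsymbol x_{t_k})\mid\boldsymbol x_{t_k}-\boldsymbol v\rangle_{\boldsymbol{\mathcal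 H}}\to 0\quad\text{as }k\to\infty.$$ Furthermore, every accumulation point $\boldsymbol x_\infty$ of $(\boldsymbol x_{t_k})_{k\in\mathbb N}$ satisfies $A\boldsymbol x_\infty\in\bigcap_{i\in I}C_i$ and $G_{f,\bigcap_{i\in I}C_i}(A\boldsymbol x_\infty)=0$, i.e., $A\boldsymbol x_\infty$ is a stationary point of the problem of minimizing $f(x)$ subject to $x\in\bigcap_{i\in I}C_i$.
   Context: $\mathcal H$ is a real Hilbert space with inner product $\langle\cdot\mid\cdot\rangle$ and norm $\|\cdot\|$; $\mathbb N=\{0,1,2,\dots\}$. $m\ge1$ is an integer, $I=\{1,\dots,m\}$, and $\{\omega_i\}_{i\in I}\subset\left]0,1\right]$ satisfies $\sum_{i\in I}\omega_i=1$. $\boldsymbol{\mathcal H}=\mathcal H^m$ is the real Hilbert space with inner product $\langle\boldsymbol x\mid\boldsymbol y\rangle_{\boldsymbol{\mathcal H}}=\sum_{i\in I}\omega_i\langle\boldsymbol x^i\mid\boldsymbol y^i\rangle$, where $\boldsymbol x=(\boldsymbol x^1,\dots,\boldsymbol x^m)$, and with the induced norm. $\boldsymbol D=\{\boldsymbol x\in\boldsymbol{\mathcal H}:\boldsymbol x^1=\dots=\boldsymbol x^m\}$ is the diagonal subspace, and $\operatorname{dist}_{\boldsymbol D}(\boldsymbol x)=\inf_{\boldsymbol z\in\boldsymbol D}\|\boldsymbol x-\boldsymbol z\|_{\boldsymbol{\mathcal H}}$. $A\colon\boldsymbol{\mathcal H}\to\mathcal H\colon\boldsymbol x\mapsto\sum_{i\in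 I}\omega_i\boldsymbol x^i$ is the averaging operator. $\prod_{i\in I}C_i=C_1\times\dots\times C_m\subset\boldsymbol{\mathcal H}$. $f$ is $L_f$-smooth if $f(y)-f(x)\le\langle\nabla f(x)\mid y-x\rangle+\frac{L_f}{2}\|y-x\|^2$ for all $x,y\in\mathcal H$. Gradients on $\boldsymbol{\mathcal H}$ are taken with respect to $\langle\cdot\mid\cdot\rangle_{\boldsymbol{\mathcal H}}$; thus the $i$th component of $\nabla F_\lambda(\boldsymbol x)$ is $\nabla f(A\boldsymbol x)+\lambda(\boldsymbol x^i-A\boldsymbol x)$. For a nonempty compact convex set $C\subset\mathcal H$, the Frank-Wolfe gap is $G_{f,C}(x)=\sup_{v\in C}\langle\nabla f(x)\mid x-v\rangle$; $x$ is a stationary point of the problem of minimizing $f$ over $C$ if and only if $x\in C$ and $G_{f,C}(x)\le0$. For $i\in I$ and $x\in\mathcal H$, $\operatorname{LMO}_i(x)$ denotes a point in $\operatorname{Argmin}_{z\in C_i}\langle x\mid z\rangle$ (any selection). Split conditional gradient algorithm, with penalty parameters $\lambda_t\in\left]0,+\infty\right[$ and step sizes $\gamma_t\in\left]0,1\right]$: start from any $\boldsymbol x_0\in\prod_{i\in I}C_i$ and set $x_0=\sum_{i\in I}\omega_i\boldsymbol x_0^i$. For $t=0,1,2,\dots$: set $g_t=\nabla f(x_t)$; for every $i\in I$ set $\boldsymbol v_t^i=\operatorname{LMO}_i(g_t+\lambda_t(\boldsymbol x_t^i-x_t))$ and $\boldsymbol x_{t+1}^i=\boldsymbol x_t^i+\gamma_t(\boldsymbol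 v_t^i-\boldsymbol x_t^i)$; then set $x_{t+1}=\sum_{i\in I}\omega_i\boldsymbol x_{t+1}^i$. The iterates are $\boldsymbol x_t=(\boldsymbol x_t^1,\dots,\boldsymbol x_t^m)$, so $x_t=A\boldsymbol x_t$. *)

theory Defs
  imports "HOL-Analysis.Analysis"
begin

text \<open>
  The real Hilbert space is a type of class \<open>{real_inner, complete_space}\<close>; the index set is a
  finite type \<open>'n\<close> (so m is \<open>CARD('n)\<close>, automatically at least 1) and the m-fold product is
  \<open>'a ^ 'n\<close>.  The library's inner product on \<open>'a ^ 'n\<close> is the unweighted one, so the weighted
  inner product and everything metric that depends on it (norm, distance, gradient) are defined
  separately.  The weighted norm is equivalent to the library norm (lemma
  \<open>wnorm_equivalent\<close> below), so convergence and Frechet differentiability on \<open>'a ^ 'n\<close> may be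
  expressed with the library's topology and \<open>has_derivative\<close>.
\<close>

definition winner :: "('n::finite \<Rightarrow> real) \<Rightarrow> 'a::real_inner ^ 'n \<Rightarrow> 'a ^ 'n \<Rightarrow> real" where
  "winner \<omega> x y = (\<Sum>i\<in>UNIV. \<omega> i * inner (x $ i) (y $ i))"

definition wnorm :: "('n::finite \<Rightarrow> real) \<Rightarrow> 'a::real_inner ^ 'n \<Rightarrow> real" where
  "wnorm \<omega> x = sqrt (winner \<omega> x x)"

lemma wnorm_equivalent:
  fixes \<omega> :: "'n::finite \<Rightarrow> real"
  assumes "\<And>i. 0 < \<omega> i" "\<And>i. \<omega> i \<le> 1"
  shows "\<exists>c>0. \<forall>x :: 'a::real_inner ^ 'n. c * norm x \<le> wnorm \<omega> x \<and> wnorm \<omega> x \<le> norm x"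
proof -
  define m where "m = Min (range \<omega>)"
  have m: "0 < m" "\<And>i. m \<le> \<omega> i"
    using assms(1) by (auto simp: m_def)
  have "sqrt m * norm x \<le> wnorm \<omega> x \<and> wnorm \<omega> x \<le> norm x" for x :: "'a ^ 'n"
  proof -
    have "m * inner x x \<le> winner \<omega> x x"
      unfolding winner_def inner_vec_def sum_distrib_left
      by (intro sum_mono mult_right_mono m inner_ge_zero)
    moreover have "winner \<omega> x x \<le> inner x x"
      unfolding winner_def inner_vec_def
      by (intro sum_mono mult_left_le_one_le inner_ge_zero assms less_imp_le)
    ultimately show ?thesis
      by (simp add: wnorm_def norm_eq_sqrt_inner flip: real_sqrt_mult)
  qed
  with m(1) show ?thesis
    by (intro exI[of _ "sqrt m"]) simp
qed

definition gradient :: "('a::real_inner \<Rightarrow> real) \<Rightarrow> 'a \<Rightarrow> 'a" where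
  "gradient f x = (THE g. GDERIV f x :> g)"

text \<open>Gradient with respect to the weighted inner product, i.e. the representer of the derivative.\<close>
definition wgradient ::
  "('n::finite \<Rightarrow> real) \<Rightarrow> ('a::real_inner ^ 'n \<Rightarrow> real) \<Rightarrow> 'a ^ 'n \<Rightarrow> 'a ^ 'n" where
  "wgradient \<omega> F x = (THE g. (F has_derivative (\<lambda>h. winner \<omega> h g)) (at x))"

definition L_smooth :: "real \<Rightarrow> ('a::real_inner \<Rightarrow> real) \<Rightarrow> bool" where
  "L_smooth L f \<longleftrightarrow>
    (\<forall>x y. f y - f x \<le> inner (gradient f x) (y - x) + L / 2 * (norm (y - x))\<^sup>2)"

definition averaging :: "('n::finite \<Rightarrow> real) \<Rightarrow> 'a::real_inner ^ 'n \<Rightarrow> 'a" where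
  "averaging \<omega> x = (\<Sum>i\<in>UNIV. \<omega> i *\<^sub>R (x $ i))"

definition diagonal :: "('a ^ 'n::finite) set" where
  "diagonal = {x. \<forall>i j. x $ i = x $ j}"

definition wdist_diagonal :: "('n::finite \<Rightarrow> real) \<Rightarrow> 'a::real_inner ^ 'n \<Rightarrow> real" where
  "wdist_diagonal \<omega> x = (INF z\<in>diagonal. wnorm \<omega> (x - z))"

definition penalized ::
  "('n::finite \<Rightarrow> real) \<Rightarrow> ('a::real_inner \<Rightarrow> real) \<Rightarrow> real \<Rightarrow> 'a ^ 'n \<Rightarrow> real" where
  "penalized \<omega> f lam x = f (averaging \<omega> x) + lam / 2 * (wdist_diagonal \<omega> x)\<^sup>2"

definition product_set :: "('n::finite \<Rightarrow> 'a set) \<Rightarrow> ('a ^ 'n) set" where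
  "product_set C = {x. \<forall>i. x $ i \<in> C i}"

definition fw_gap :: "('a::real_inner \<Rightarrow> real) \<Rightarrow> 'a set \<Rightarrow> 'a \<Rightarrow> real" where
  "fw_gap f C x = (SUP v\<in>C. inner (gradient f x) (x - v))"

definition penalized_gap ::
  "('n::finite \<Rightarrow> real) \<Rightarrow> ('a::real_inner \<Rightarrow> real) \<Rightarrow> ('n \<Rightarrow> 'a set) \<Rightarrow> real \<Rightarrow> 'a ^ 'n \<Rightarrow> real" where
  "penalized_gap \<omega> f C lam x =
    (SUP v\<in>product_set C. winner \<omega> (wgradient \<omega> (penalized \<omega> f lam) x) (x - v))"

definition stationary_point :: "('a::real_inner \<Rightarrow> real) \<Rightarrow> 'a set \<Rightarrow> 'a \<Rightarrow> bool" where
  "stationary_point f C x \<longleftrightarrow> x \<in> C \<and> fw_gap f C x \<le> 0"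

definition linear_minimization_oracle :: "'a::real_inner set \<Rightarrow> ('a \<Rightarrow> 'a) \<Rightarrow> bool" where
  "linear_minimization_oracle C lmo \<longleftrightarrow> (\<forall>x. is_arg_min (\<lambda>z. inner x z) (\<lambda>z. z \<in> C) (lmo x))"

definition split_cg_iterates ::
  "('n::finite \<Rightarrow> real) \<Rightarrow> ('a::real_inner \<Rightarrow> real) \<Rightarrow> ('n \<Rightarrow> 'a set) \<Rightarrow> ('n \<Rightarrow> 'a \<Rightarrow> 'a) \<Rightarrow>
    (nat \<Rightarrow> real) \<Rightarrow> (nat \<Rightarrow> real) \<Rightarrow> (nat \<Rightarrow> 'a ^ 'n) \<Rightarrow> bool" where
  "split_cg_iterates \<omega> f C LMO \<gamma> lam x \<longleftrightarrow>
    x 0 \<in> product_set C \<and>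
    (\<forall>t i. let g = gradient f (averaging \<omega> (x t));
               v = LMO i (g + lam t *\<^sub>R (x t $ i - averaging \<omega> (x t)))
           in x (Suc t) $ i = x t $ i + \<gamma> t *\<^sub>R (v - x t $ i))"

definition seq_accumulation_point :: "(nat \<Rightarrow> 'a::topological_space) \<Rightarrow> 'a \<Rightarrow> bool" where
  "seq_accumulation_point X l \<longleftrightarrow> (\<exists>s. strict_mono s \<and> (X \<circ> s) \<longlonglongrightarrow> l)"

end

theory Submission
  imports Defs "HOL-Real_Asymp.Real_Asymp"
begin

text \<open>
  The algorithm is a conditional gradient method on the product space for an objective that changes with
  the penalty, and its gap there controls both the stationarity and the infeasibility of the averages.
  Write \<open>F\<^sub>\<lambda>\<close> for the penalized objective, \<open>A\<close> for the averaging operator and \<open>d\<close> for the squared distance to the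
  diagonal.

  \<^emph>\<open>Rate.\<close>  Since \<open>d(x) = \<parallel>x\<parallel>\<^sup>2 - \<parallel>A x\<parallel>\<^sup>2\<close> in the weighted norm (\<open>wdist_diagonal_power2\<close>),
  \<open>F\<^sub>\<lambda>\<close> is \<open>(L + \<lambda>)\<close>-smooth, and the componentwise oracle minimizes its linearization over the whole
  product.  One step therefore gives
  \<open>\<gamma>\<^sub>k gap\<^sub>k \<le> F\<^sub>k(x\<^sub>k) - F\<^sub>k(x\<^sub>k\<^sub>+\<^sub>1) + O(\<gamma>\<^sub>k\<^sup>2 (L + \<lambda>\<^sub>k))\<close>.  Dividing by \<open>\<gamma>\<^sub>k\<close> and summing, the \<open>f\<close>-part
  and the \<open>d\<close>-part are both sums of decrements of a bounded sequence with nondecreasing weights,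
  namely \<open>\<surd>(k + 1)\<close> and \<open>\<lambda>\<^sub>k \<surd>(k + 1) / 2\<close>; summation by parts (\<open>sum_weighted_decrease_le\<close>) bounds such
  a sum by a constant times its last weight, so that the change of the penalty does not worsen the order.  The sum of
  the first \<open>t\<close> gaps is thus \<open>O(\<surd>t (1 + \<lambda>\<^sub>t))\<close> (\<open>sum_penalized_gap_le\<close>), and \<open>\<lambda>\<^sub>t\<close> grows
  like \<open>ln t\<close> because it is a multiple of a harmonic number (\<open>harmonic_penalty\<close>).  The gaps are
  nonnegative and their averages vanish, so a subsequence of them vanishes.

  \<^emph>\<open>Stationarity.\<close>  Testing the gap at a constant vector \<open>(c, \<dots>, c)\<close> with \<open>c\<close> in the intersection
  of the sets gives \<open>\<langle>\<nabla>f(A x), A x - c\<rangle> + \<lambda> d(x) \<le> gap\<close> (\<open>penalized_gap_ge_diagonal\<close>).  To pass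
  to the limit without continuity of the gradient, smoothness is used to bound the inner product from below
  by a difference quotient of \<open>f\<close>, which is continuous in the base point
  (\<open>L_smooth_difference_quotient_le\<close>).  As \<open>\<lambda> \<rightarrow> \<infinity>\<close> the first term stays bounded below, so \<open>d \<rightarrow> 0\<close>
  and the limit is diagonal; dropping \<open>\<lambda> d \<ge> 0\<close> instead and then letting the step of the quotient
  tend to zero gives \<open>\<langle>\<nabla>f(y), y - c\<rangle> \<le> 0\<close> at the limit \<open>y\<close> of the averages.
\<close>

section \<open>Summation by parts and the growth of the penalties\<close>

text \<open>
  Summation by parts leaves \<open>w\<^sub>0 a\<^sub>0 + \<Sum> (w\<^sub>k - w\<^sub>k\<^sub>-\<^sub>1) a\<^sub>k - w\<^sub>n a\<^sub>n\<^sub>+\<^sub>1\<close>, whose coefficients of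
  \<open>a\<^sub>0, \<dots>, a\<^sub>n\<close> are nonnegative and add up to \<open>w\<^sub>n\<close>.
\<close>
lemma sum_weighted_decrease_le:
  fixes w a :: "nat \<Rightarrow> real"
  assumes "mono w" "0 \<le> w 0" and a: "\<And>k. a k \<le> M"
  shows "(\<Sum>k\<le>n. w k * (a k - a (Suc k))) \<le> w n * (M - a (Suc n))"
proof (induction n)
  case 0
  show ?case using assms by (simp add: mult_left_mono)
next
  case (Suc n)
  have "w n * (M - a (Suc n)) \<le> w (Suc n) * (M - a (Suc n))"
    using a \<open>mono w\<close> by (intro mult_right_mono) (auto simp: mono_def)
  with Suc show ?case by (simp add: algebra_simps)
qed

lemma sum_inverse_sqrt_le: "(\<Sum>k<n. 1 / sqrt (real k + 1)) \<le> 2 * sqrt (real n)"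
proof (induction n)
  case (Suc n)
  define a b where "a = sqrt (real n)" "b = sqrt (real n + 1)"
  have ab: "0 \<le> a" "a \<le> b" "0 < b" "a * a = real n" "b * b = a * a + 1"
    by (simp_all add: a_b_def)
  \<comment> \<open>As \<open>1 = b\<^sup>2 - a\<^sup>2\<close>, this is \<open>(b - a)\<^sup>2 \<ge> 0\<close>.\<close>
  have "2 * a * b + 1 \<le> 2 * b * b"
  proof -
    have "0 \<le> (b - a)\<^sup>2" by simp
    then show ?thesis using ab by (simp add: power2_eq_square algebra_simps)
  qed
  then have "2 * a + 1 / b \<le> 2 * b"
    using ab by (simp add: field_simps)
  with Suc show ?case by (simp add: a_b_def add.commute)
qed simp

lemma harm_le_1_plus_ln: "1 \<le> n \<Longrightarrow> harm n \<le> 1 + ln (real n)"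
  using euler_mascheroni_sequence_decreasing[of 1 n] by (simp add: harm_expand)

text \<open>
  If the terms were eventually at least some \<open>e > 0\<close>, the limit of the averages would be at least \<open>e\<close>; hence terms
  below \<open>1 / (k + 1)\<close> occur arbitrarily late.
\<close>
lemma exists_subseq_tendsto_0:
  fixes g :: "nat \<Rightarrow> real"
  assumes nonneg: "\<And>k. 0 \<le> g k"
    and avg: "(\<lambda>t. (\<Sum>k<t. g k) / real t) \<longlonglongrightarrow> 0"
  shows "\<exists>r :: nat \<Rightarrow> nat. strict_mono r \<and> (\<lambda>k. g (r k)) \<longlonglongrightarrow> 0"
proof -
  have small: "\<exists>k>N. g k < e" if "0 < e" for e N
  proof (rule ccontr)
    assume "\<not> ?thesis"
    then have e: "e \<le> g k" if "N < k" for k using that by force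
    have "e * (real t - real N - 1) \<le> (\<Sum>k<t. g k)" for t
    proof (induction t)
      case 0
      then show ?case using \<open>0 < e\<close> by (simp add: mult_nonneg_nonpos)
    next
      case (Suc t)
      show ?case
      proof (cases "N < t")
        case True
        then show ?thesis using Suc e[of t] by (simp add: algebra_simps)
      next
        case False
        then have "e * (real (Suc t) - real N - 1) \<le> 0"
          using \<open>0 < e\<close> by (intro mult_nonneg_nonpos) auto
        then show ?thesis using sum_nonneg[of "{..<Suc t}" g] nonneg by fastforce
      qed
    qed
    then have "e * (real t - real N - 1) / real t \<le> (\<Sum>k<t. g k) / real t" for t
      by (intro divide_right_mono) auto
    moreover have "(\<lambda>t. e * (real t - real N - 1) / real t) \<longlonglongrightarrow> e"
      by real_asymp
    ultimately have "e \<le> 0"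
      using avg by (intro tendsto_le[OF sequentially_bot]) auto
    with \<open>0 < e\<close> show False by simp
  qed
  have "\<exists>r. \<forall>k. g (r k) < 1 / (real k + 1) \<and> r k < r (Suc k)"
  proof (rule dependent_nat_choice)
    show "\<exists>y. g y < 1 / (real 0 + 1)" using small[of 1] by auto
    show "\<exists>y. g y < 1 / (real (Suc n) + 1) \<and> x < y" for x n
      using small[of "1 / (real (Suc n) + 1)" x] by auto
  qed
  then obtain r where r: "strict_mono r" "\<And>k. g (r k) < 1 / (real k + 1)"
    by (auto simp: strict_mono_Suc_iff)
  have "(\<lambda>k. g (r k)) \<longlonglongrightarrow> 0"
  proof (rule tendsto_sandwich)
    show "(\<lambda>k. 0 :: real) \<longlonglongrightarrow> 0" by simp
    show "(\<lambda>k. 1 / (real k + 1)) \<longlonglongrightarrow> 0" by real_asymp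
  qed (use r nonneg less_imp_le in \<open>auto intro!: always_eventually\<close>)
  with r show ?thesis by auto
qed

text \<open>
  For positive indices \<open>lam t = lam 0 * harm t\<close>, so everything follows from the growth of harmonic
  numbers.  At the index 0 the empty sum would give 0 instead of \<open>lam 0\<close>; the shift to \<open>Suc t\<close>
  makes the logarithmic bound hold there too.
\<close>
lemma harmonic_penalty:
  fixes lam :: "nat \<Rightarrow> real"
  assumes lam0: "0 < lam 0" and step: "\<And>t. 1 \<le> t \<Longrightarrow> lam t = lam 0 * (\<Sum>k<t. 1 / (real k + 1))"
  shows "mono lam" and "0 < lam t" and "lam t \<le> lam 0 * (1 + ln (real (Suc t)))"
    and "filterlim lam at_top sequentially"
proof -
  have harm: "lam t = lam 0 * harm t" if "1 \<le> t" for t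
    unfolding step[OF that] by (simp add: harm_altdef inverse_eq_divide add.commute)
  show mono: "mono lam"
  proof (rule incseq_SucI)
    fix n show "lam n \<le> lam (Suc n)"
    proof (cases "n = 0")
      case True
      with harm[of 1] show ?thesis by (simp add: harm_expand)
    next
      case False
      then show ?thesis
        using harm[of n] harm[of "Suc n"] lam0
        by (metis One_nat_def Suc_le_eq harm_mono le_SucI le_refl less_imp_le mult_left_mono
            neq0_conv zero_less_Suc)
    qed
  qed
  then have "lam 0 \<le> lam t" by (simp add: monoD)
  with lam0 show "0 < lam t" by linarith
  show "lam t \<le> lam 0 * (1 + ln (real (Suc t)))"
  proof (cases "t = 0")
    case False
    then have "harm t \<le> 1 + ln (real t)" by (intro harm_le_1_plus_ln) simp
    also have "\<dots> \<le> 1 + ln (real (Suc t))" using False by simp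
    finally show ?thesis using lam0 False by (simp add: harm)
  qed simp
  have "filterlim (\<lambda>t. lam 0 * harm t) at_top sequentially"
    using lam0 harm_at_top by (intro filterlim_tendsto_pos_mult_at_top[OF tendsto_const])
  moreover have "\<forall>\<^sub>F t in sequentially. lam 0 * harm t = lam t"
    using eventually_ge_at_top[of 1] by eventually_elim (rule harm[symmetric])
  ultimately show "filterlim lam at_top sequentially"
    by (simp only: filterlim_cong[OF refl refl])
qed

section \<open>Gradients in a real Hilbert space\<close>

text \<open>
  The representer is the minimizer of \<open>\<parallel>u\<parallel>\<^sup>2 / 2 - \<phi> u\<close>: by the parallelogram law minimizing
  sequences are Cauchy, and the derivative of this functional vanishes at its minimum.  This is what makes
  \<open>gradient f\<close> meaningful for a differentiable \<open>f\<close>.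
\<close>
lemma riesz_representation:
  fixes \<phi> :: "'a::{real_inner, complete_space} \<Rightarrow> real"
  assumes \<phi>: "bounded_linear \<phi>"
  shows "\<exists>g. \<forall>h. \<phi> h = inner h g"
proof -
  interpret bounded_linear \<phi> by fact
  define J where "J u = (norm u)\<^sup>2 / 2 - \<phi> u" for u
  obtain K where K: "\<And>u. \<bar>\<phi> u\<bar> \<le> norm u * K"
    using bounded by auto
  have "- K\<^sup>2 / 2 \<le> J u" for u
  proof -
    have "0 \<le> (norm u - K)\<^sup>2" by simp
    moreover have "\<phi> u \<le> norm u * K" using K[of u] by linarith
    ultimately show ?thesis
      by (simp add: J_def power2_eq_square field_simps)
  qed
  then have bdd: "bdd_below (range J)"
    by (intro bdd_belowI) auto
  define m where "m = Inf (range J)"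
  have m_le: "m \<le> J u" for u
    unfolding m_def using bdd by (simp add: cInf_lower)
  have "\<exists>u. J u < m + 1 / (real n + 1)" for n
    using cInf_lessD[of "range J" "m + 1 / (real n + 1)"] by (auto simp: m_def)
  then obtain u where u: "\<And>n. J (u n) < m + 1 / (real n + 1)"
    by metis
  have parallelogram: "(norm (a - b))\<^sup>2 / 4 = J a + J b - 2 * J ((1 / 2) *\<^sub>R (a + b))" for a b
    by (simp add: J_def power2_norm_eq_inner scaleR add inner_simps field_simps inner_commute)
  have dist_le: "(dist (u i) (u j))\<^sup>2 \<le> 8 / (real n + 1)" if "n \<le> i" "n \<le> j" for i j n
  proof -
    have "(norm (u i - u j))\<^sup>2 / 4 \<le> 1 / (real i + 1) + 1 / (real j + 1)"
      using parallelogram[of "u i" "u j"] u[of i] u[of j] m_le[of "(1 / 2) *\<^sub>R (u i + u j)"]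
      by linarith
    also have "\<dots> \<le> 1 / (real n + 1) + 1 / (real n + 1)"
      using that by (intro add_mono divide_left_mono) auto
    finally show ?thesis by (simp add: dist_norm)
  qed
  have "Cauchy u"
  proof (rule metric_CauchyI)
    fix e :: real assume e: "0 < e"
    obtain n :: nat where "8 / e\<^sup>2 < real n" using reals_Archimedean2 by blast
    then have "8 < e\<^sup>2 * real n" using e by (simp add: field_simps)
    then have n: "8 / (real n + 1) < e\<^sup>2"
      using e by (simp add: field_simps add_strict_increasing)
    have "dist (u i) (u j) < e" if "n \<le> i" "n \<le> j" for i j
      using dist_le[OF that] n e by (intro power2_less_imp_less[of _ e]) auto
    then show "\<exists>n. \<forall>i\<ge>n. \<forall>j\<ge>n. dist (u i) (u j) < e" by blast
  qed
  then obtain g where g: "u \<longlonglongrightarrow> g"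
    using Cauchy_convergent convergent_def by blast
  have "(\<lambda>n. J (u n)) \<longlonglongrightarrow> J g"
    unfolding J_def by (intro tendsto_intros tendsto g) simp
  moreover have "(\<lambda>n. m + 1 / (real n + 1)) \<longlonglongrightarrow> m + 0"
    by (intro tendsto_intros) real_asymp
  ultimately have "J g \<le> m + 0"
    using u by (intro tendsto_le[OF sequentially_bot]) (auto intro!: always_eventually less_imp_le)
  then have min: "J g \<le> J v" for v
    using m_le[of v] by linarith
  have "((\<lambda>v. inner v v / 2 - \<phi> v) has_derivative (\<lambda>h. inner h g - \<phi> h)) (at g)"
    by (rule derivative_eq_intros bounded_linear_imp_has_derivative[OF \<phi>] refl
        | simp add: inner_commute)+
  then have "(\<lambda>h. inner h g - \<phi> h) = (\<lambda>h. 0)"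
    using min by (intro has_derivative_local_min) (auto simp: J_def power2_norm_eq_inner)
  then show ?thesis
    by (metis eq_iff_diff_eq_0)
qed

lemma GDERIV_gradient:
  fixes f :: "'a::{real_inner, complete_space} \<Rightarrow> real"
  assumes "f differentiable (at x)"
  shows "GDERIV f x :> gradient f x"
proof -
  obtain \<phi> where \<phi>: "(f has_derivative \<phi>) (at x)"
    using assms by (auto simp: differentiable_def)
  then obtain g where g: "\<And>h. \<phi> h = inner h g"
    using riesz_representation has_derivative_bounded_linear by blast
  have "\<phi> = (\<lambda>h. inner h g)" using g by auto
  with \<phi> have "GDERIV f x :> g" by (simp add: gderiv_def)
  moreover have "g' = g" if "GDERIV f x :> g'" for g'
  proof -
    have "(\<lambda>h. inner h g') = (\<lambda>h. inner h g)"
      using that \<open>GDERIV f x :> g\<close> unfolding gderiv_def by (rule has_derivative_unique)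
    then have "inner (g' - g) g' = inner (g' - g) g" by meson
    then have "inner (g' - g) (g' - g) = 0" by (simp add: inner_diff_right)
    then show ?thesis by simp
  qed
  ultimately show ?thesis
    unfolding gradient_def by (rule theI)
qed

text \<open>
  Smoothness, applied to a step \<^emph>\<open>away\<close> from \<open>c\<close>, turns the upper quadratic bound into a lower bound
  on the gradient term.  For differentiable \<open>f\<close> and fixed \<open>s\<close> the left-hand side depends
  continuously on \<open>y\<close>, and it tends to the right-hand side as \<open>s \<rightarrow> 0\<close>.
\<close>
lemma L_smooth_difference_quotient_le:
  assumes "L_smooth L f" "0 < s"
  shows "(f (y + s *\<^sub>R (y - c)) - f y) / s - L / 2 * s * (norm (y - c))\<^sup>2
    \<le> inner (gradient f y) (y - c)"
proof -
  have "f (y + s *\<^sub>R (y - c)) - f y \<le>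
      s * (inner (gradient f y) (y - c) + L / 2 * s * (norm (y - c))\<^sup>2)"
    using assms(1)[unfolded L_smooth_def, rule_format, of "y + s *\<^sub>R (y - c)" y]
    by (simp add: power_mult_distrib power2_eq_square distrib_left mult_ac)
  then have "(f (y + s *\<^sub>R (y - c)) - f y) / s \<le>
      inner (gradient f y) (y - c) + L / 2 * s * (norm (y - c))\<^sup>2"
    using assms(2) by (simp add: pos_divide_le_eq mult.commute)
  then show ?thesis by simp
qed

section \<open>The weighted product space\<close>

lemma winner_simps:
  "winner \<omega> (x + y) z = winner \<omega> x z + winner \<omega> y z"
  "winner \<omega> (x - y) z = winner \<omega> x z - winner \<omega> y z"
  "winner \<omega> (c *\<^sub>R x) z = c * winner \<omega> x z"
  "winner \<omega> x (y + z) = winner \<omega> x y + winner \<omega> x z"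
  "winner \<omega> x (y - z) = winner \<omega> x y - winner \<omega> x z"
  "winner \<omega> x (c *\<^sub>R z) = c * winner \<omega> x z"
  by (simp_all add: winner_def inner_simps algebra_simps sum.distrib sum_subtractf sum_distrib_left)

lemma winner_commute: "winner \<omega> x y = winner \<omega> y x"
  by (simp add: winner_def inner_commute)

lemma averaging_simps:
  "averaging \<omega> (x + y) = averaging \<omega> x + averaging \<omega> y"
  "averaging \<omega> (x - y) = averaging \<omega> x - averaging \<omega> y"
  "averaging \<omega> (c *\<^sub>R x) = c *\<^sub>R averaging \<omega> x"
  by (simp_all add: averaging_def algebra_simps sum.distrib sum_subtractf scaleR_sum_right)

lemma winner_const_left: "winner \<omega> (\<chi> i. d) y = inner d (averaging \<omega> y)"
  by (simp add: winner_def averaging_def inner_sum_right)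

lemma winner_const_right: "winner \<omega> y (\<chi> i. d) = inner (averaging \<omega> y) d"
  by (simp add: winner_def averaging_def inner_sum_left)

lemma bounded_linear_averaging: "bounded_linear (averaging \<omega>)"
  unfolding averaging_def
  by (intro bounded_linear_sum bounded_linear_const_scaleR bounded_linear_vec_nth)

context
  fixes \<omega> :: "'n::finite \<Rightarrow> real"
  assumes \<omega>_pos: "\<And>i. 0 < \<omega> i" and \<omega>_sum: "(\<Sum>i\<in>UNIV. \<omega> i) = 1"
begin

lemma winner_nonneg: "0 \<le> winner \<omega> x x"
  unfolding winner_def
  by (intro sum_nonneg mult_nonneg_nonneg inner_ge_zero less_imp_le[OF \<omega>_pos])

lemma winner_eq_0D: "winner \<omega> x x = 0 \<Longrightarrow> x = 0"
proof -
  assume "winner \<omega> x x = 0"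
  then have "\<forall>i\<in>UNIV. \<omega> i * inner (x $ i) (x $ i) = 0"
    unfolding winner_def
    by (subst (asm) sum_nonneg_eq_0_iff) (auto intro!: mult_nonneg_nonneg less_imp_le[OF \<omega>_pos])
  then show "x = 0"
    using \<omega>_pos by (simp add: vec_eq_iff) (metis less_irrefl)
qed

lemma averaging_const: "averaging \<omega> (\<chi> i. d) = d"
  by (simp add: averaging_def \<omega>_sum flip: scaleR_sum_left)

text \<open>
  The bias-variance decomposition: constant vectors are orthogonal to \<open>x\<close> minus its average.
\<close>
lemma winner_diff_const:
  "winner \<omega> (x - (\<chi> i. d)) (x - (\<chi> i. d)) =
    winner \<omega> x x - (norm (averaging \<omega> x))\<^sup>2 + (norm (averaging \<omega> x - d))\<^sup>2"
  by (simp add: winner_simps winner_const_left winner_const_right averaging_const averaging_simps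
      power2_norm_eq_inner inner_simps inner_commute)

text \<open>
  By \<open>winner_diff_const\<close> the nearest diagonal point is the constant vector with value
  \<open>averaging \<omega> x\<close>.  This quadratic form can be expanded and differentiated, which the infimum cannot.
\<close>
lemma wdist_diagonal_power2:
  "(wdist_diagonal \<omega> x)\<^sup>2 = winner \<omega> x x - (norm (averaging \<omega> x))\<^sup>2"
proof -
  let ?P = "winner \<omega> x x - (norm (averaging \<omega> x))\<^sup>2"
  let ?c = "(\<chi> i. averaging \<omega> x) :: 'a ^ 'n"
  have P: "winner \<omega> (x - ?c) (x - ?c) = ?P"
    by (simp add: winner_diff_const)
  have P0: "0 \<le> ?P"
    using winner_nonneg[of "x - ?c"] by (simp add: P)
  have "wdist_diagonal \<omega> x = sqrt ?P"
    unfolding wdist_diagonal_def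
  proof (rule cInf_eq_minimum)
    have "?c \<in> diagonal" by (simp add: diagonal_def)
    then show "sqrt ?P \<in> (\<lambda>z. wnorm \<omega> (x - z)) ` diagonal"
      by (intro image_eqI[of _ _ ?c]) (auto simp: wnorm_def P)
  next
    fix r assume "r \<in> (\<lambda>z. wnorm \<omega> (x - z)) ` diagonal"
    then obtain z where z: "z \<in> diagonal" "r = wnorm \<omega> (x - z)" by auto
    from z(1) have "z = (\<chi> i. z $ undefined)"
      unfolding diagonal_def vec_eq_iff vec_lambda_beta by blast
    then obtain d where "z = (\<chi> i. d)"
      by (rule that)
    then show "sqrt ?P \<le> r"
      by (simp add: z wnorm_def winner_diff_const)
  qed
  with P0 show ?thesis by simp
qed

lemma norm_averaging_power2_le: "(norm (averaging \<omega> x))\<^sup>2 \<le> winner \<omega> x x"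
  using zero_le_power2[of "wdist_diagonal \<omega> x"] by (simp add: wdist_diagonal_power2)

lemma winner_le:
  assumes "\<And>i. norm (x $ i) \<le> B"
  shows "winner \<omega> x x \<le> B\<^sup>2"
proof -
  have "winner \<omega> x x \<le> (\<Sum>i\<in>UNIV. \<omega> i * B\<^sup>2)"
    unfolding winner_def
  proof (intro sum_mono mult_left_mono less_imp_le[OF \<omega>_pos])
    fix i
    have "(norm (x $ i))\<^sup>2 \<le> B\<^sup>2" using assms by (intro power_mono) auto
    then show "inner (x $ i) (x $ i) \<le> B\<^sup>2" by (simp add: power2_norm_eq_inner)
  qed
  also have "\<dots> = B\<^sup>2" by (simp add: \<omega>_sum sum_distrib_right[symmetric])
  finally show ?thesis .
qed

lemma wgradient_eqI:
  assumes "(F has_derivative (\<lambda>h. winner \<omega> h g)) (at x)"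
  shows "wgradient \<omega> F x = g"
  unfolding wgradient_def
proof (rule the_equality)
  show "(F has_derivative (\<lambda>h. winner \<omega> h g)) (at x)" by (rule assms)
next
  fix g' assume "(F has_derivative (\<lambda>h. winner \<omega> h g')) (at x)"
  then have "(\<lambda>h. winner \<omega> h g') = (\<lambda>h. winner \<omega> h g)"
    using assms by (rule has_derivative_unique)
  then have "winner \<omega> (g' - g) g' = winner \<omega> (g' - g) g" by meson
  then have "winner \<omega> (g' - g) (g' - g) = 0" by (simp add: winner_simps(5))
  from winner_eq_0D[OF this] show "g' = g" by simp
qed

section \<open>The penalized objective\<close>

definition penalized_gradient ::
  "('a::real_inner \<Rightarrow> real) \<Rightarrow> real \<Rightarrow> 'a ^ 'n \<Rightarrow> 'a ^ 'n" where
  "penalized_gradient f lam x =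
    (\<chi> i. gradient f (averaging \<omega> x) + lam *\<^sub>R (x $ i - averaging \<omega> x))"

lemma penalized_eq:
  "penalized \<omega> f lam x =
    f (averaging \<omega> x) + lam / 2 * (winner \<omega> x x - (norm (averaging \<omega> x))\<^sup>2)"
  by (simp add: penalized_def wdist_diagonal_power2)

lemma winner_penalized_gradient:
  "winner \<omega> h (penalized_gradient f lam x) =
    inner (averaging \<omega> h) (gradient f (averaging \<omega> x)) +
    lam * (winner \<omega> h x - inner (averaging \<omega> h) (averaging \<omega> x))"
proof -
  have "penalized_gradient f lam x = (\<chi> i. gradient f (averaging \<omega> x)) +
      lam *\<^sub>R (x - (\<chi> i. averaging \<omega> x))"
    by (simp add: penalized_gradient_def vec_eq_iff)
  then show ?thesis
    by (simp add: winner_simps winner_const_right)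
qed

lemma wgradient_penalized:
  fixes f :: "'a::{real_inner, complete_space} \<Rightarrow> real"
  assumes "\<And>z. f differentiable (at z)"
  shows "wgradient \<omega> (penalized \<omega> f lam) x = penalized_gradient f lam x"
proof (rule wgradient_eqI)
  have A: "(averaging \<omega> has_derivative averaging \<omega>) (at x)"
    by (rule bounded_linear_imp_has_derivative[OF bounded_linear_averaging])
  have f: "((\<lambda>y. f (averaging \<omega> y)) has_derivative
      (\<lambda>h. inner (averaging \<omega> h) (gradient f (averaging \<omega> x)))) (at x)"
    using has_derivative_compose[OF A GDERIV_gradient[OF assms, unfolded gderiv_def]] .
  have W: "((\<lambda>y. winner \<omega> y y) has_derivative (\<lambda>h. 2 * winner \<omega> h x)) (at x)"
    unfolding winner_def
    by (rule derivative_eq_intros refl bounded_linear_imp_has_derivative bounded_linear_vec_nth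
        | simp add: inner_commute sum_distrib_left algebra_simps)+
  have N: "((\<lambda>y. (norm (averaging \<omega> y))\<^sup>2) has_derivative
      (\<lambda>h. 2 * inner (averaging \<omega> h) (averaging \<omega> x))) (at x)"
    unfolding power2_norm_eq_inner
    by (auto intro!: derivative_eq_intros A simp: inner_commute)
  have "((\<lambda>y. f (averaging \<omega> y) + lam / 2 * (winner \<omega> y y - (norm (averaging \<omega> y))\<^sup>2))
      has_derivative (\<lambda>h. inner (averaging \<omega> h) (gradient f (averaging \<omega> x)) +
        lam / 2 * (2 * winner \<omega> h x - 2 * inner (averaging \<omega> h) (averaging \<omega> x)))) (at x)"
    by (intro has_derivative_add f has_derivative_mult_right has_derivative_diff W N)
  then show "(penalized \<omega> f lam has_derivative
      (\<lambda>h. winner \<omega> h (penalized_gradient f lam x))) (at x)"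
    by (simp add: penalized_eq[abs_def] winner_penalized_gradient algebra_simps)
qed

text \<open>
  Along a line the penalty is an exact quadratic with leading coefficient \<open>lam / 2\<close> times
  \<open>\<parallel>h\<parallel>\<^sup>2 - \<parallel>A h\<parallel>\<^sup>2\<close>.  The quadratic error of \<open>f\<close> is \<open>L / 2\<close>
  times \<open>\<parallel>A h\<parallel>\<^sup>2\<close>.  Both squares are at most \<open>\<parallel>h\<parallel>\<^sup>2\<close>, so the smoothness constants add up.
\<close>
lemma penalized_descent:
  assumes smooth: "L_smooth L f" and "0 \<le> L" "0 \<le> lam"
  shows "penalized \<omega> f lam (x + s *\<^sub>R h) \<le>
    penalized \<omega> f lam x + s * winner \<omega> h (penalized_gradient f lam x) +
    s\<^sup>2 / 2 * (L + lam) * winner \<omega> h h"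
proof -
  let ?A = "averaging \<omega>"
  have "f (?A x + s *\<^sub>R ?A h) - f (?A x) \<le>
      s * inner (?A h) (gradient f (?A x)) + L / 2 * (s\<^sup>2 * (norm (?A h))\<^sup>2)"
    using smooth[unfolded L_smooth_def, rule_format, of "?A x + s *\<^sub>R ?A h" "?A x"]
    by (simp add: inner_commute power_mult_distrib)
  also have "L / 2 * (s\<^sup>2 * (norm (?A h))\<^sup>2) \<le> L / 2 * (s\<^sup>2 * winner \<omega> h h)"
    using norm_averaging_power2_le[of h] assms by (intro mult_left_mono) auto
  finally have f: "f (?A x + s *\<^sub>R ?A h) \<le> f (?A x) +
      s * inner (?A h) (gradient f (?A x)) + L / 2 * (s\<^sup>2 * winner \<omega> h h)"
    by simp
  let ?P = "\<lambda>x. winner \<omega> x x - (norm (?A x))\<^sup>2"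
  have P: "?P (x + s *\<^sub>R h) =
      ?P x + 2 * s * (winner \<omega> h x - inner (?A h) (?A x)) + s\<^sup>2 * ?P h"
    unfolding power2_norm_eq_inner
    by (simp add: winner_simps averaging_simps inner_simps winner_commute[of _ x h]
        inner_commute power2_eq_square algebra_simps)
  have "lam / 2 * ?P (x + s *\<^sub>R h) = lam / 2 * ?P x +
      s * lam * (winner \<omega> h x - inner (?A h) (?A x)) + lam / 2 * (s\<^sup>2 * ?P h)"
    unfolding P by (simp add: algebra_simps)
  also have "lam / 2 * (s\<^sup>2 * ?P h) \<le> lam / 2 * (s\<^sup>2 * winner \<omega> h h)"
    using assms by (intro mult_left_mono) auto
  finally show ?thesis
    using f unfolding penalized_eq winner_penalized_gradient averaging_simps
    by (simp add: algebra_simps add_divide_distrib)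
qed

text \<open>
  The weighted inner product with a fixed vector is a positive combination of the components, so over a
  product of sets it is minimized componentwise.  Hence the supremum in the gap is attained.
\<close>
lemma penalized_gap_eq_linear_minimum:
  fixes f :: "'a::{real_inner, complete_space} \<Rightarrow> real"
  assumes diff: "\<And>z. f differentiable (at z)"
    and v: "\<And>i. is_arg_min (inner (penalized_gradient f lam x $ i)) (\<lambda>z. z \<in> C i) (v $ i)"
  shows "penalized_gap \<omega> f C lam x = winner \<omega> (x - v) (penalized_gradient f lam x)"
    and "w \<in> product_set C \<Longrightarrow>
      winner \<omega> (x - w) (penalized_gradient f lam x) \<le> penalized_gap \<omega> f C lam x"
proof -
  let ?G = "penalized_gradient f lam x"
  have le: "winner \<omega> (x - w) ?G \<le> winner \<omega> (x - v) ?G" if "w \<in> product_set C" for w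
    unfolding winner_def
  proof (intro sum_mono mult_left_mono less_imp_le[OF \<omega>_pos])
    fix i
    have "inner (?G $ i) (v $ i) \<le> inner (?G $ i) (w $ i)"
      using v[of i] that by (auto simp: is_arg_min_linorder product_set_def)
    then show "inner ((x - w) $ i) (?G $ i) \<le> inner ((x - v) $ i) (?G $ i)"
      by (simp add: inner_diff_left inner_diff_right inner_commute)
  qed
  have v_in: "v \<in> product_set C"
    using v by (simp add: is_arg_min_linorder product_set_def)
  show eq: "penalized_gap \<omega> f C lam x = winner \<omega> (x - v) ?G"
    unfolding penalized_gap_def wgradient_penalized[OF diff]
    by (rule cSup_eq_maximum) (use v_in le in \<open>auto simp: winner_commute[of _ ?G]\<close>)
  show "winner \<omega> (x - w) ?G \<le> penalized_gap \<omega> f C lam x" if "w \<in> product_set C"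
    unfolding eq using le[OF that] .
qed

text \<open>
  The penalty part of the gradient is \<open>lam\<close> times the component of \<open>x\<close> orthogonal to the diagonal;
  its product with \<open>x - (c, \<dots>, c)\<close> is \<open>lam\<close> times the squared distance, whatever \<open>c\<close> is.
\<close>
lemma penalized_gap_ge_diagonal:
  fixes f :: "'a::{real_inner, complete_space} \<Rightarrow> real"
  assumes diff: "\<And>z. f differentiable (at z)"
    and lmo: "\<And>i. linear_minimization_oracle (C i) (LMO i)"
    and c: "c \<in> (\<Inter>i. C i)"
  shows "inner (gradient f (averaging \<omega> x)) (averaging \<omega> x - c) + lam * (wdist_diagonal \<omega> x)\<^sup>2
    \<le> penalized_gap \<omega> f C lam x"
proof -
  let ?G = "penalized_gradient f lam x"
  have "winner \<omega> (x - (\<chi> i. c)) ?G \<le> penalized_gap \<omega> f C lam x"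
    by (rule penalized_gap_eq_linear_minimum(2)[OF diff, of _ _ _ "\<chi> i. LMO i (?G $ i)"])
      (use lmo c in \<open>auto simp: linear_minimization_oracle_def product_set_def\<close>)
  moreover have "winner \<omega> (x - (\<chi> i. c)) ?G =
      inner (gradient f (averaging \<omega> x)) (averaging \<omega> x - c) + lam * (wdist_diagonal \<omega> x)\<^sup>2"
    unfolding winner_penalized_gradient
    by (simp add: averaging_simps averaging_const winner_simps winner_const_left
        wdist_diagonal_power2 power2_norm_eq_inner inner_simps inner_commute)
  ultimately show ?thesis by simp
qed

text \<open>
  The image is a weighted Minkowski sum of finitely many compact sets.  It serves to bound \<open>f\<close> along the
  averages of the iterates; in infinite dimension boundedness of the sets would not suffice.
\<close>
lemma compact_averaging_product_set:
  fixes C :: "'n \<Rightarrow> 'a::real_inner set"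
  assumes "\<And>i. compact (C i)"
  shows "compact (averaging \<omega> ` product_set C)"
proof -
  have "compact {\<Sum>i\<in>S. \<omega> i *\<^sub>R c i |c. \<forall>i. c i \<in> C i}" if "finite S" for S
    using that
  proof (induction S)
    case empty
    show ?case by (rule finite_imp_compact, rule finite_subset[of _ "{0}"]) auto
  next
    case (insert j S)
    let ?T = "{\<Sum>i\<in>S. \<omega> i *\<^sub>R c i |c. \<forall>i. c i \<in> C i}"
    have "{\<Sum>i\<in>insert j S. \<omega> i *\<^sub>R c i |c. \<forall>i. c i \<in> C i} =
        {y + z |y z. y \<in> (\<lambda>u. \<omega> j *\<^sub>R u) ` C j \<and> z \<in> ?T}" (is "?l = ?r")
    proof
      show "?l \<subseteq> ?r" using insert by fastforce
      show "?r \<subseteq> ?l"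
      proof
        fix w assume "w \<in> ?r"
        then obtain u c where w: "w = \<omega> j *\<^sub>R u + (\<Sum>i\<in>S. \<omega> i *\<^sub>R c i)" "u \<in> C j" "\<forall>i. c i \<in> C i"
          by auto
        have "(\<Sum>i\<in>S. \<omega> i *\<^sub>R (c(j := u)) i) = (\<Sum>i\<in>S. \<omega> i *\<^sub>R c i)"
          using insert by (intro sum.cong) auto
        then show "w \<in> ?l"
          using insert w by (auto intro!: exI[of _ "c(j := u)"])
      qed
    qed
    moreover have "compact ((\<lambda>u. \<omega> j *\<^sub>R u) ` C j)"
      by (intro compact_scaling assms)
    ultimately show ?case
      using compact_sums insert.IH by fastforce
  qed
  from this[of UNIV] have "compact {\<Sum>i\<in>UNIV. \<omega> i *\<^sub>R c i |c. \<forall>i. c i \<in> C i}" by simp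
  also have "{\<Sum>i\<in>UNIV. \<omega> i *\<^sub>R c i |c. \<forall>i. c i \<in> C i} = averaging \<omega> ` product_set C"
  proof (intro subset_antisym subsetI)
    fix y assume "y \<in> {\<Sum>i\<in>UNIV. \<omega> i *\<^sub>R c i |c. \<forall>i. c i \<in> C i}"
    then obtain c where "y = averaging \<omega> (\<chi> i. c i)" "\<forall>i. c i \<in> C i"
      by (auto simp: averaging_def)
    then show "y \<in> averaging \<omega> ` product_set C"
      by (intro image_eqI) (auto simp: product_set_def)
  qed (auto simp: averaging_def product_set_def)
  finally show ?thesis .
qed

section \<open>Convergence rate of the averaged gaps\<close>

lemma split_cg_step:
  fixes f :: "'a::{real_inner, complete_space} \<Rightarrow> real" and x :: "nat \<Rightarrow> 'a ^ 'n"
  assumes diff: "\<And>z. f differentiable (at z)"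
    and lmo: "\<And>i. linear_minimization_oracle (C i) (LMO i)"
    and iterates: "split_cg_iterates \<omega> f C LMO \<gamma> lam x"
  obtains v where "v \<in> product_set C" and "x (Suc t) = x t + \<gamma> t *\<^sub>R (v - x t)"
    and "penalized_gap \<omega> f C (lam t) (x t) =
      winner \<omega> (x t - v) (penalized_gradient f (lam t) (x t))"
proof
  let ?G = "penalized_gradient f (lam t) (x t)"
  let ?v = "\<chi> i. LMO i (?G $ i)"
  have min: "is_arg_min (inner (?G $ i)) (\<lambda>z. z \<in> C i) (?v $ i)" for i
    using lmo by (simp add: linear_minimization_oracle_def)
  then show "?v \<in> product_set C"
    by (simp add: product_set_def is_arg_min_linorder)
  show "penalized_gap \<omega> f C (lam t) (x t) = winner \<omega> (x t - ?v) ?G"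
    by (rule penalized_gap_eq_linear_minimum(1)[OF diff min])
  show "x (Suc t) = x t + \<gamma> t *\<^sub>R (?v - x t)"
    using iterates by (simp add: vec_eq_iff split_cg_iterates_def Let_def penalized_gradient_def)
qed

lemma split_cg_iterates_in_product_set:
  fixes f :: "'a::{real_inner, complete_space} \<Rightarrow> real"
  assumes diff: "\<And>z. f differentiable (at z)"
    and conv: "\<And>i. convex (C i)"
    and lmo: "\<And>i. linear_minimization_oracle (C i) (LMO i)"
    and \<gamma>: "\<And>t. 0 \<le> \<gamma> t" "\<And>t. \<gamma> t \<le> 1"
    and iterates: "split_cg_iterates \<omega> f C LMO \<gamma> lam x"
  shows "x t \<in> product_set C"
proof (induction t)
  case 0
  show ?case using iterates by (simp add: split_cg_iterates_def)
next
  case (Suc t)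
  obtain v where v: "v \<in> product_set C" "x (Suc t) = x t + \<gamma> t *\<^sub>R (v - x t)"
    using split_cg_step[OF diff lmo iterates] by metis
  have "(1 - \<gamma> t) *\<^sub>R (x t $ i) + \<gamma> t *\<^sub>R (v $ i) \<in> C i" for i
    using Suc v \<gamma>[of t] by (intro convexD[OF conv]) (auto simp: product_set_def)
  then show ?case
    by (simp add: v product_set_def algebra_simps)
qed

text \<open>
  The error term \<open>\<gamma>\<^sub>k (L + lam k)\<close> sums to \<open>O(\<surd>n (L + lam n))\<close>, the same order as the two sums
  treated by \<open>sum_weighted_decrease_le\<close>: this is the balance behind the choice of step sizes.
\<close>
lemma sum_penalized_gap_le:
  fixes f :: "'a::{real_inner, complete_space} \<Rightarrow> real" and x :: "nat \<Rightarrow> 'a ^ 'n"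
  assumes diff: "\<And>z. f differentiable (at z)"
    and smooth: "L_smooth L f" and "0 \<le> L"
    and comp: "\<And>i. compact (C i)" and conv: "\<And>i. convex (C i)"
    and lmo: "\<And>i. linear_minimization_oracle (C i) (LMO i)"
    and \<gamma>: "\<And>t. \<gamma> t = 1 / sqrt (real t + 1)"
    and lam_mono: "mono lam" and lam_pos: "\<And>t. 0 < lam t"
    and iterates: "split_cg_iterates \<omega> f C LMO \<gamma> lam x"
  obtains K\<^sub>1 K\<^sub>2 where "0 \<le> K\<^sub>1" "0 \<le> K\<^sub>2"
    "\<And>n. (\<Sum>k\<le>n. penalized_gap \<omega> f C (lam k) (x k)) \<le> sqrt (real n + 1) * (K\<^sub>1 + K\<^sub>2 * lam n)"
proof -
  let ?A = "averaging \<omega>"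
  let ?gap = "\<lambda>k. penalized_gap \<omega> f C (lam k) (x k)"
  define w where "w k = sqrt (real k + 1)" for k
  define d where "d k = (wdist_diagonal \<omega> (x k))\<^sup>2" for k
  have w_pos: "0 < w k" and \<gamma>_w: "\<gamma> k = 1 / w k" for k by (simp_all add: w_def \<gamma>)
  have "mono w" by (simp add: w_def mono_def)
  have \<gamma>01: "0 \<le> \<gamma> k" "\<gamma> k \<le> 1" for k by (simp_all add: \<gamma>)
  have x_in: "x k \<in> product_set C" for k
    by (rule split_cg_iterates_in_product_set[OF diff conv lmo \<gamma>01 iterates])
  have "bounded (\<Union>i. C i)"
    using comp by (intro bounded_UN) (auto intro: compact_imp_bounded)
  then obtain B where "\<And>c. c \<in> (\<Union>i. C i) \<Longrightarrow> norm c \<le> B"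
    by (auto simp: bounded_iff)
  then have B: "norm (z $ i) \<le> B" if "z \<in> product_set C" for z i
    using that by (auto simp: product_set_def)
  have "continuous_on UNIV f"
    using diff by (simp add: continuous_at_imp_continuous_on differentiable_imp_continuous_within)
  then have "compact (f ` ?A ` product_set C)"
    by (intro compact_continuous_image compact_averaging_product_set comp)
      (auto intro: continuous_on_subset)
  then have "bounded (f ` ?A ` product_set C)" by (rule compact_imp_bounded)
  then obtain M where "\<forall>y\<in>f ` ?A ` product_set C. \<bar>y\<bar> \<le> M"
    unfolding bounded_iff real_norm_def by blast
  then have M: "\<bar>f (?A z)\<bar> \<le> M" if "z \<in> product_set C" for z
    using that by blast
  have M0: "0 \<le> M" using M[OF x_in[of 0]] by linarith
  have d: "0 \<le> d k" "d k \<le> B\<^sup>2" for k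
  proof -
    show "0 \<le> d k" by (simp add: d_def)
    have "d k \<le> winner \<omega> (x k) (x k)" by (simp add: d_def wdist_diagonal_power2)
    also have "\<dots> \<le> B\<^sup>2" by (intro winner_le B x_in)
    finally show "d k \<le> B\<^sup>2" .
  qed
  \<comment> \<open>The descent inequality for one step, divided by the step size \<open>1 / w k\<close>.\<close>
  have gap: "?gap k \<le> w k * (f (?A (x k)) - f (?A (x (Suc k)))) +
      w k * lam k / 2 * (d k - d (Suc k)) + 2 * B\<^sup>2 * (L + lam k) * (1 / w k)" for k
  proof -
    obtain v where v: "v \<in> product_set C" "x (Suc k) = x k + \<gamma> k *\<^sub>R (v - x k)"
      "?gap k = winner \<omega> (x k - v) (penalized_gradient f (lam k) (x k))"
      using split_cg_step[OF diff lmo iterates] by metis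
    \<comment> \<open>The crude diameter \<open>2 * B\<close> suffices, since only the order in \<open>n\<close> matters.\<close>
    have "norm ((v - x k) $ i) \<le> 2 * B" for i
      using norm_triangle_ineq4[of "v $ i" "x k $ i"] B[OF v(1), of i] B[OF x_in, of k i] by simp
    then have "winner \<omega> (v - x k) (v - x k) \<le> (2 * B)\<^sup>2" by (rule winner_le)
    then have "(\<gamma> k)\<^sup>2 / 2 * (L + lam k) * winner \<omega> (v - x k) (v - x k) \<le>
        (\<gamma> k)\<^sup>2 / 2 * (L + lam k) * (2 * B)\<^sup>2"
      using \<open>0 \<le> L\<close> lam_pos[of k] by (intro mult_left_mono mult_nonneg_nonneg) auto
    moreover have "winner \<omega> (v - x k) (penalized_gradient f (lam k) (x k)) = - ?gap k"
      by (simp add: v(3) winner_simps)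
    ultimately have "\<gamma> k * ?gap k \<le> penalized \<omega> f (lam k) (x k) -
        penalized \<omega> f (lam k) (x (Suc k)) + (\<gamma> k)\<^sup>2 / 2 * (L + lam k) * (2 * B)\<^sup>2"
      using penalized_descent[OF smooth \<open>0 \<le> L\<close> less_imp_le[OF lam_pos], of k "x k" "\<gamma> k" "v - x k"]
      by (simp add: v(2))
    then have "w k * (\<gamma> k * ?gap k) \<le> w k * (penalized \<omega> f (lam k) (x k) -
        penalized \<omega> f (lam k) (x (Suc k)) + (\<gamma> k)\<^sup>2 / 2 * (L + lam k) * (2 * B)\<^sup>2)"
      using w_pos by (intro mult_left_mono) (auto intro: less_imp_le)
    also have "w k * (\<gamma> k * ?gap k) = ?gap k"
      using w_pos[of k] by (simp add: \<gamma>_w)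
    also have "w k * (penalized \<omega> f (lam k) (x k) -
        penalized \<omega> f (lam k) (x (Suc k)) + (\<gamma> k)\<^sup>2 / 2 * (L + lam k) * (2 * B)\<^sup>2) =
        w k * (penalized \<omega> f (lam k) (x k) - penalized \<omega> f (lam k) (x (Suc k))) +
        2 * B\<^sup>2 * (L + lam k) * (w k * (\<gamma> k)\<^sup>2)"
      by (simp add: power2_eq_square algebra_simps)
    also have "w k * (\<gamma> k)\<^sup>2 = 1 / w k"
      using w_pos[of k] by (simp add: \<gamma>_w power2_eq_square)
    also have "w k * (penalized \<omega> f (lam k) (x k) - penalized \<omega> f (lam k) (x (Suc k))) =
        w k * (f (?A (x k)) - f (?A (x (Suc k)))) + w k * lam k / 2 * (d k - d (Suc k))"
      by (simp add: penalized_def d_def algebra_simps)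
    finally show ?thesis .
  qed
  have main: "(\<Sum>k\<le>n. ?gap k) \<le> w n * ((2 * M + 4 * B\<^sup>2 * L) + (B\<^sup>2 / 2 + 4 * B\<^sup>2) * lam n)" for n
  proof -
    have "(\<Sum>k\<le>n. w k * (f (?A (x k)) - f (?A (x (Suc k))))) \<le> w n * (M - f (?A (x (Suc n))))"
      using M[OF x_in] \<open>mono w\<close> w_pos[of 0]
      by (intro sum_weighted_decrease_le) (auto simp: abs_le_iff)
    also have "\<dots> \<le> w n * (2 * M)"
      using M[OF x_in, of "Suc n"] w_pos[of n] by (intro mult_left_mono) auto
    finally have 1: "(\<Sum>k\<le>n. w k * (f (?A (x k)) - f (?A (x (Suc k))))) \<le> w n * (2 * M)" .
    have "mono (\<lambda>k. w k * lam k / 2)"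
      using \<open>mono w\<close> lam_mono
      by (auto simp: mono_def intro!: divide_right_mono mult_mono less_imp_le[OF w_pos] less_imp_le[OF lam_pos])
    then have "(\<Sum>k\<le>n. w k * lam k / 2 * (d k - d (Suc k))) \<le> w n * lam n / 2 * (B\<^sup>2 - d (Suc n))"
      using d w_pos[of 0] lam_pos[of 0] by (intro sum_weighted_decrease_le) auto
    also have "\<dots> \<le> w n * lam n / 2 * B\<^sup>2"
      using d w_pos[of n] lam_pos[of n] by (intro mult_left_mono) auto
    finally have 2: "(\<Sum>k\<le>n. w k * lam k / 2 * (d k - d (Suc k))) \<le> w n * lam n / 2 * B\<^sup>2" .
    have "(\<Sum>k\<le>n. 2 * B\<^sup>2 * (L + lam k) * (1 / w k)) \<le> (\<Sum>k\<le>n. 2 * B\<^sup>2 * (L + lam n) * (1 / w k))"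
      using w_pos lam_mono
      by (intro sum_mono mult_right_mono mult_left_mono add_left_mono)
        (auto simp: mono_def intro: less_imp_le)
    also have "\<dots> = 2 * B\<^sup>2 * (L + lam n) * (\<Sum>k<Suc n. 1 / w k)"
      by (simp only: sum_distrib_left lessThan_Suc_atMost)
    also have "\<dots> \<le> 2 * B\<^sup>2 * (L + lam n) * (2 * w n)"
      using sum_inverse_sqrt_le[of "Suc n"] \<open>0 \<le> L\<close> lam_pos[of n]
      by (intro mult_left_mono mult_nonneg_nonneg) (auto simp: w_def add.commute)
    finally have 3: "(\<Sum>k\<le>n. 2 * B\<^sup>2 * (L + lam k) * (1 / w k)) \<le> 2 * B\<^sup>2 * (L + lam n) * (2 * w n)" .
    have "(\<Sum>k\<le>n. ?gap k) \<le> (\<Sum>k\<le>n. w k * (f (?A (x k)) - f (?A (x (Suc k)))) +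
      w k * lam k / 2 * (d k - d (Suc k)) + 2 * B\<^sup>2 * (L + lam k) * (1 / w k))"
      by (intro sum_mono gap)
    also have "\<dots> \<le> w n * (2 * M) + w n * lam n / 2 * B\<^sup>2 + 2 * B\<^sup>2 * (L + lam n) * (2 * w n)"
      unfolding sum.distrib using 1 2 3 by linarith
    finally show ?thesis by (simp add: algebra_simps)
  qed
  show thesis
    by (rule that[OF _ _ main[unfolded w_def]]) (use M0 \<open>0 \<le> L\<close> in auto)
qed

section \<open>Stationarity of accumulation points\<close>

text \<open>
  Along a convergent sequence with unbounded penalties and vanishing gaps, \<open>q_gap\<close> below is used
  twice: with a fixed step \<open>s = 1\<close> to force the limit onto the diagonal, and with \<open>s \<rightarrow> 0\<close> to obtain
  the variational inequality there.
\<close>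
lemma penalized_gap_limit_stationary:
  fixes f :: "'a::{real_inner, complete_space} \<Rightarrow> real" and z :: "nat \<Rightarrow> 'a ^ 'n"
  assumes diff: "\<And>z. f differentiable (at z)"
    and smooth: "L_smooth L f"
    and closed: "\<And>i. closed (C i)" and inter: "(\<Inter>i. C i) \<noteq> {}"
    and lmo: "\<And>i. linear_minimization_oracle (C i) (LMO i)"
    and z_in: "\<And>k. z k \<in> product_set C" and z_lim: "z \<longlonglongrightarrow> z_inf"
    and lam_pos: "\<And>k. 0 < lam k" and lam_lim: "filterlim lam at_top sequentially"
    and gap: "(\<lambda>k. penalized_gap \<omega> f C (lam k) (z k)) \<longlonglongrightarrow> 0"
  shows "averaging \<omega> z_inf \<in> (\<Inter>i. C i)"
    and "fw_gap f (\<Inter>i. C i) (averaging \<omega> z_inf) = 0"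
proof -
  let ?A = "averaging \<omega>" and ?gap = "\<lambda>k. penalized_gap \<omega> f C (lam k) (z k)"
  \<comment> \<open>The lower bound of \<open>L_smooth_difference_quotient_le\<close>, continuous in \<open>y\<close> for fixed \<open>s\<close>.\<close>
  define q where "q c s y = (f (y + s *\<^sub>R (y - c)) - f y) / s - L / 2 * s * (norm (y - c))\<^sup>2" for c s y
  have A_lim: "(\<lambda>k. ?A (z k)) \<longlonglongrightarrow> ?A z_inf"
    by (rule bounded_linear.tendsto[OF bounded_linear_averaging z_lim])
  have f_lim: "(\<lambda>k. f (g k)) \<longlonglongrightarrow> f l" if "g \<longlonglongrightarrow> l" for g l
    by (rule isCont_tendsto_compose[OF differentiable_imp_continuous_within[OF diff] that])
  have q_lim: "(\<lambda>k. q c s (?A (z k))) \<longlonglongrightarrow> q c s (?A z_inf)" if "0 < s" for c s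
    unfolding q_def using that by (intro tendsto_intros f_lim A_lim) auto
  have q_gap: "q c s (?A (z k)) + lam k * (wdist_diagonal \<omega> (z k))\<^sup>2 \<le> ?gap k"
    if "0 < s" "c \<in> (\<Inter>i. C i)" for c s k
    using penalized_gap_ge_diagonal[OF diff lmo that(2), of "z k" "lam k"]
      L_smooth_difference_quotient_le[OF smooth that(1), of "?A (z k)" c]
    by (simp add: q_def)
  have "z_inf = (\<chi> i. ?A z_inf)"
  proof -
    obtain c where c: "c \<in> (\<Inter>i. C i)" using inter by auto
    have "(\<lambda>k. (?gap k - q c 1 (?A (z k))) / lam k) \<longlonglongrightarrow> 0"
      using lam_lim
      by (intro tendsto_divide_0[OF tendsto_diff[OF gap q_lim]])
        (auto intro: filterlim_at_top_imp_at_infinity)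
    moreover have "(wdist_diagonal \<omega> (z k))\<^sup>2 \<le> (?gap k - q c 1 (?A (z k))) / lam k" for k
      using q_gap[of 1 c k] c lam_pos[of k] by (simp add: field_simps)
    moreover have "(\<lambda>k. (wdist_diagonal \<omega> (z k))\<^sup>2) \<longlonglongrightarrow> (wdist_diagonal \<omega> z_inf)\<^sup>2"
      unfolding wdist_diagonal_power2 unfolding winner_def
      by (intro tendsto_intros A_lim z_lim)
    ultimately have "(wdist_diagonal \<omega> z_inf)\<^sup>2 \<le> 0"
      by (intro tendsto_le[OF sequentially_bot]) auto
    then have "winner \<omega> (z_inf - (\<chi> i. ?A z_inf)) (z_inf - (\<chi> i. ?A z_inf)) = 0"
      using zero_le_power2[of "wdist_diagonal \<omega> z_inf"]
      by (simp add: winner_diff_const flip: wdist_diagonal_power2)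
    from winner_eq_0D[OF this] show ?thesis by simp
  qed
  then have A_nth: "?A z_inf = z_inf $ i" for i
    by (metis vec_lambda_beta)
  show A_in: "?A z_inf \<in> (\<Inter>i. C i)"
  proof (rule INT_I)
    fix i
    have "z k $ i \<in> C i" for k
      using z_in by (simp add: product_set_def)
    then show "?A z_inf \<in> C i"
      unfolding A_nth[of i]
      by (rule closed_sequentially[OF closed]) (rule tendsto_vec_nth[OF z_lim])
  qed
  have le: "inner (gradient f (?A z_inf)) (?A z_inf - c) \<le> 0" if c: "c \<in> (\<Inter>i. C i)" for c
  proof -
    let ?y = "?A z_inf" and ?h = "?A z_inf - c"
    have "q c s ?y \<le> 0" if "0 < s" for s
    proof (rule tendsto_le[OF sequentially_bot gap q_lim[OF that]])
      have "q c s (?A (z k)) \<le> ?gap k" for k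
        using q_gap[OF that c, of k] lam_pos[of k]
        by (smt (verit) mult_nonneg_nonneg zero_le_power2)
      then show "\<forall>\<^sub>F k in sequentially. q c s (?A (z k)) \<le> ?gap k" by simp
    qed
    moreover have "((\<lambda>s. q c s ?y) \<longlongrightarrow> inner (gradient f ?y) ?h - L / 2 * 0 * (norm ?h)\<^sup>2) (at_right 0)"
      unfolding q_def
    proof (intro tendsto_intros)
      have line: "((\<lambda>s. ?y + s *\<^sub>R ?h) has_derivative (\<lambda>s. s *\<^sub>R ?h)) (at 0)"
        by (auto intro!: derivative_eq_intros)
      have "((\<lambda>s. f (?y + s *\<^sub>R ?h)) has_derivative (\<lambda>s. inner (s *\<^sub>R ?h) (gradient f ?y))) (at 0)"
        by (rule has_derivative_compose[OF line])
          (use GDERIV_gradient[OF diff, of ?y] in \<open>simp add: gderiv_def\<close>)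
      then have "((\<lambda>s. f (?y + s *\<^sub>R ?h)) has_field_derivative inner (gradient f ?y) ?h) (at 0)"
        by (simp add: has_field_derivative_def inner_commute mult_commute_abs)
      then have "((\<lambda>s. (f (?y + s *\<^sub>R ?h) - f ?y) / s) \<longlongrightarrow> inner (gradient f ?y) ?h) (at 0)"
        by (simp add: DERIV_def)
      then show "((\<lambda>s. (f (?y + s *\<^sub>R ?h) - f ?y) / s) \<longlongrightarrow> inner (gradient f ?y) ?h) (at_right 0)"
        by (simp add: filterlim_at_split)
    qed
    ultimately show ?thesis
      by (intro tendsto_upperbound[of "\<lambda>s. q c s ?y" _ "at_right 0"])
        (auto intro: eventually_mono[OF eventually_at_right_less])
  qed
  show "fw_gap f (\<Inter>i. C i) (?A z_inf) = 0"
    unfolding fw_gap_def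
    by (rule cSup_eq_maximum) (use A_in le in \<open>force+\<close>)
qed

end

theorem theorem3p6:
  fixes f :: "'a::{real_inner, complete_space} \<Rightarrow> real"
    and L\<^sub>f :: real
    and \<omega> :: "'n::finite \<Rightarrow> real"
    and C :: "'n \<Rightarrow> 'a set"
    and R :: "'n \<Rightarrow> real"
    and LMO :: "'n \<Rightarrow> 'a \<Rightarrow> 'a"
    and \<gamma> lam :: "nat \<Rightarrow> real"
    and x :: "nat \<Rightarrow> 'a ^ 'n"
  assumes weights: "\<And>i. 0 < \<omega> i" "\<And>i. \<omega> i \<le> 1" "(\<Sum>i\<in>UNIV. \<omega> i) = 1"
    and L_pos: "L\<^sub>f > 0"
    and f_diff: "\<And>z. f differentiable (at z)"
    and f_smooth: "L_smooth L\<^sub>f f"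
    and C: "\<And>i. C i \<noteq> {}" "\<And>i. compact (C i)" "\<And>i. convex (C i)"
    and R: "\<And>i. R i = diameter (C i)"
    and C_inter: "(\<Inter>i. C i) \<noteq> {}"
    and LMO: "\<And>i. linear_minimization_oracle (C i) (LMO i)"
    and step: "\<And>t. \<gamma> t = 1 / sqrt (real t + 1)"
    and lam_init: "lam 0 > 0"
    and lam_step: "\<And>t. t \<ge> 1 \<Longrightarrow> lam t = lam 0 * (\<Sum>k<t. 1 / (real k + 1))"
    and iterates: "split_cg_iterates \<omega> f C LMO \<gamma> lam x"
  shows "(\<exists>K. \<forall>t\<ge>1.
            0 \<le> (1 / real t) * (\<Sum>k<t. penalized_gap \<omega> f C (lam k) (x k)) \<and>
            (1 / real t) * (\<Sum>k<t. penalized_gap \<omega> f C (lam k) (x k))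
              \<le> K * (ln (real t) / sqrt (real t) + 1 / sqrt (real t))) \<and>
         (\<exists>r :: nat \<Rightarrow> nat. strict_mono r \<and>
            (\<lambda>k. penalized_gap \<omega> f C (lam (r k)) (x (r k))) \<longlonglongrightarrow> 0) \<and>
         (\<forall>r :: nat \<Rightarrow> nat. strict_mono r \<longrightarrow>
            (\<lambda>k. penalized_gap \<omega> f C (lam (r k)) (x (r k))) \<longlonglongrightarrow> 0 \<longrightarrow>
            (\<forall>x_inf. seq_accumulation_point (\<lambda>k. x (r k)) x_inf \<longrightarrow>
               averaging \<omega> x_inf \<in> (\<Inter>i. C i) \<and>
               fw_gap f (\<Inter>i. C i) (averaging \<omega> x_inf) = 0 \<and>
               stationary_point f (\<Inter>i. C i) (averaging \<omega> x_inf)))"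
proof -
  let ?gap = "\<lambda>k. penalized_gap \<omega> f C (lam k) (x k)"
  note \<omega> = weights(1,3)
  have lam: "mono lam" "0 < lam t" "lam t \<le> lam 0 * (1 + ln (real (Suc t)))"
    "filterlim lam at_top sequentially" for t
    by (-, (rule harmonic_penalty[where lam = lam, OF lam_init], erule lam_step)+)
  have \<gamma>01: "0 \<le> \<gamma> t" "\<gamma> t \<le> 1" for t by (simp_all add: step)
  have x_in: "x k \<in> product_set C" for k
    by (rule split_cg_iterates_in_product_set[OF \<omega> f_diff C(3) LMO \<gamma>01 iterates])
  have gap_nonneg: "0 \<le> ?gap k" for k
  proof -
    let ?v = "\<chi> i. LMO i (penalized_gradient \<omega> f (lam k) (x k) $ i)"
    have "winner \<omega> (x k - x k) (penalized_gradient \<omega> f (lam k) (x k)) \<le> ?gap k"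
      by (rule penalized_gap_eq_linear_minimum(2)[where v = ?v, OF \<omega> f_diff _ x_in])
        (use LMO in \<open>simp add: linear_minimization_oracle_def\<close>)
    then show ?thesis by (simp add: winner_def)
  qed
  obtain K\<^sub>1 K\<^sub>2 where K: "0 \<le> K\<^sub>1" "0 \<le> K\<^sub>2"
    "\<And>n. (\<Sum>k\<le>n. ?gap k) \<le> sqrt (real n + 1) * (K\<^sub>1 + K\<^sub>2 * lam n)"
    using sum_penalized_gap_le[OF \<omega> f_diff f_smooth less_imp_le[OF L_pos] C(2,3) LMO step
        lam(1,2) iterates] by blast
  define K where "K = K\<^sub>1 + K\<^sub>2 * lam 0"
  have rate: "(1 / real t) * (\<Sum>k<t. ?gap k) \<le> K * (ln (real t) / sqrt (real t) + 1 / sqrt (real t))"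
    if "1 \<le> t" for t
  proof -
    from that obtain n where t: "t = Suc n" by (cases t) auto
    let ?E = "1 + ln (real t)"
    have E: "1 \<le> ?E" using that by simp
    have "(\<Sum>k<t. ?gap k) \<le> sqrt (real t) * (K\<^sub>1 + K\<^sub>2 * lam n)"
      using K(3)[of n] by (simp add: t lessThan_Suc_atMost add.commute)
    also have "\<dots> \<le> sqrt (real t) * (K\<^sub>1 * ?E + K\<^sub>2 * (lam 0 * ?E))"
      using K(1,2) E lam(3)[of n]
      by (intro mult_left_mono add_mono) (auto simp: t mult_le_cancel_left1)
    also have "\<dots> = sqrt (real t) * (K * ?E)" by (simp add: K_def algebra_simps)
    finally have "(1 / real t) * (\<Sum>k<t. ?gap k) \<le> (1 / real t) * (sqrt (real t) * (K * ?E))"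
      by (intro mult_left_mono) auto
    also have "\<dots> = (sqrt (real t) / real t) * (K * ?E)" by simp
    also have "sqrt (real t) / real t = 1 / sqrt (real t)"
      using that by (simp add: field_simps)
    also have "1 / sqrt (real t) * (K * ?E) = K * (ln (real t) / sqrt (real t) + 1 / sqrt (real t))"
      by (simp add: algebra_simps)
    finally show ?thesis .
  qed
  have "(\<lambda>t. (\<Sum>k<t. ?gap k) / real t) \<longlonglongrightarrow> 0"
  proof (rule tendsto_sandwich)
    show "(\<lambda>t. 0 :: real) \<longlonglongrightarrow> 0" by simp
    show "\<forall>\<^sub>F t in sequentially. 0 \<le> (\<Sum>k<t. ?gap k) / real t"
      by (intro always_eventually allI divide_nonneg_nonneg sum_nonneg gap_nonneg) simp
    show "(\<lambda>t. K * (ln (real t) / sqrt (real t) + 1 / sqrt (real t))) \<longlonglongrightarrow> 0"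
      by real_asymp
    show "\<forall>\<^sub>F t in sequentially.
        (\<Sum>k<t. ?gap k) / real t \<le> K * (ln (real t) / sqrt (real t) + 1 / sqrt (real t))"
      using rate by (intro eventually_sequentiallyI[of 1]) simp
  qed
  then have subseq: "\<exists>r. strict_mono r \<and> (\<lambda>k. ?gap (r k)) \<longlonglongrightarrow> 0"
    by (intro exists_subseq_tendsto_0 gap_nonneg)
  have stationary: "averaging \<omega> x_inf \<in> (\<Inter>i. C i) \<and>
      fw_gap f (\<Inter>i. C i) (averaging \<omega> x_inf) = 0"
    if r: "strict_mono r" "(\<lambda>k. ?gap (r k)) \<longlonglongrightarrow> 0"
      and acc: "seq_accumulation_point (\<lambda>k. x (r k)) x_inf" for r x_inf
  proof -
    obtain s where s: "strict_mono s" "(\<lambda>k. x (r (s k))) \<longlonglongrightarrow> x_inf"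
      using acc by (auto simp: seq_accumulation_point_def o_def)
    have "filterlim (\<lambda>k. r (s k)) sequentially sequentially"
      using strict_mono_o[OF r(1) s(1)] by (simp add: filterlim_subseq o_def)
    then have lam_lim: "filterlim (\<lambda>k. lam (r (s k))) at_top sequentially"
      by (rule filterlim_compose[OF lam(4)])
    have gap_lim: "(\<lambda>k. ?gap (r (s k))) \<longlonglongrightarrow> 0"
      using LIMSEQ_subseq_LIMSEQ[OF r(2) s(1)] by (simp add: o_def)
    show ?thesis
      using penalized_gap_limit_stationary[OF \<omega> f_diff f_smooth compact_imp_closed[OF C(2)]
          C_inter LMO x_in s(2) lam(2) lam_lim gap_lim] by blast
  qed
  show ?thesis
  proof (intro conjI)
    show "\<exists>K. \<forall>t\<ge>1. 0 \<le> (1 / real t) * (\<Sum>k<t. ?gap k) \<and>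
        (1 / real t) * (\<Sum>k<t. ?gap k) \<le> K * (ln (real t) / sqrt (real t) + 1 / sqrt (real t))"
      using rate by (intro exI[of _ K]) (auto intro!: divide_nonneg_nonneg sum_nonneg gap_nonneg)
  qed (use subseq stationary in \<open>auto simp: stationary_point_def\<close>)
qed

end
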